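(* For any integers $n_1, n_2, n_3, n_4$ whose sum $n_1+n_2+n_3+n_4$ is odd there is a (piecewise-linear) almost embedding $f: K_4 \to \mathbb{R}^2$ such that $w_f(j) = n_j$ for every $j = 1, 2, 3, 4$.
   Context: $K_4$ is the complete graph on the vertices $\{1,2,3,4\}$. A polygonal line $A_1\ldots A_m$ is a tuple $(A_1,\ldots,A_m)$ of points in the plane; a closed polygonal line $A_1\ldots A_m$ is a tuple $(A_1,\ldots,A_m,A_1)$. The same notation denotes the union of segments $\bigcup_{i=1}^{m-1}A_iA_{i+1}$ (respectively $\bigcup_{i=1}^{m-1}A_iA_{i+1}\cup A_mA_1$ in the closed case). A piecewise-linear map $f:K_4\to\mathbb{R}^2$ is a collection of points $f(1),f(2),f(3),f(4)\in\mathbb{R}^2$ together with, for each edge $ab$, a polygonal line joining $f(a)$ to $f(b)$. For an oriented edge $ab$, $f|_{ab}$ denotes this polygonal line traversed from $f(a)$ to $f(b)$ (so $f|_{ba}$ is $f|_{ab}$ in reverse order), and $f(ab)$ denotes its image (union of segments). Edges are non-adjacent if they share no vertex. A piecewise-linear map $f:K_4\to\mathbb{R}^2$ is an almost embedding if $f(\alpha)\cap f(\beta)=\varnothing$ for any two non-adjacent edges $\alpha,\beta$ of $K_4$. "Almost embedding" means piecewise-linear almost embedding. For points $A,B\neq O$ in the plane, the oriented angle $\angle AOB$ is the number $t\in(-\pi,\pi]$ such that $\overrightarrow{OB}$ is codirected to the vector obtained from $\overrightarrow{OA}$ by rotation (counterclockwise) through $t$. For a closed polygonal line $A_1\ldots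 A_m$ not passing through a point $O$, its winding number around $O$ is the integer $w(A_1\ldots A_m,O)$ given by $$2\pi\cdot w(A_1\ldots A_m,O)=\angle A_1OA_2+\angle A_2OA_3+\ldots+\angle A_{m-1}OA_m+\angle A_mOA_1.$$ For $j=1,2,3,4$ let $C_j$ be the directed cycle in $K_4$ obtained by deleting $j$ from $1234$, i.e. $C_1=234$, $C_2=134$, $C_3=124$, $C_4=123$. For $C_j=abc$, $f|_{C_j}$ is the closed polygonal line obtained by concatenating $f|_{ab}$, $f|_{bc}$, $f|_{ca}$. For an almost embedding $f$, $w_f(j):=w(f|_{C_j},f(j))$. *)

theory Defs
  imports "HOL-Analysis.Analysis"
begin

text \<open>The plane is the type \<^typ>\<open>complex\<close>, in which counterclockwise rotation through \<open>t\<close>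
  is multiplication by \<^term>\<open>cis t\<close>. A polygonal line is the list of its points; a closed
  polygonal line is listed without repeating the first point at the end.\<close>

definition polyline_image :: "complex list \<Rightarrow> complex set" where
  "polyline_image ps = (\<Union>i<length ps - 1. closed_segment (ps ! i) (ps ! Suc i))"

text \<open>Only meaningful for \<open>A \<noteq> O\<close> and \<open>B \<noteq> O\<close>. The positive factor \<open>r\<close> expresses that
  the vector \<open>OB\<close> is codirected to the rotated vector \<open>OA\<close>.\<close>

definition oriented_angle :: "complex \<Rightarrow> complex \<Rightarrow> complex \<Rightarrow> real" where
  "oriented_angle A O' B =
     (THE t. - pi < t \<and> t \<le> pi \<and> (\<exists>r>0. B - O' = complex_of_real r * (cis t * (A - O'))))"

text \<open>Indices are taken modulo the length, so that the last summand is the angle from the last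
  point back to the first.\<close>

definition total_angle :: "complex list \<Rightarrow> complex \<Rightarrow> real" where
  "total_angle ps O' =
     (\<Sum>i<length ps. oriented_angle (ps ! i) O' (ps ! (Suc i mod length ps)))"

definition polygon_winding :: "complex list \<Rightarrow> complex \<Rightarrow> int" where
  "polygon_winding ps O' = (THE w. 2 * pi * real_of_int w = total_angle ps O')"

lemma oriented_angle_eq_Arg:
  assumes "A \<noteq> O'" "B \<noteq> O'"
  shows "oriented_angle A O' B = Arg ((B - O') / (A - O'))"
  unfolding oriented_angle_def
proof (rule the_equality)
  let ?z = "(B - O') / (A - O')"
  have z: "?z \<noteq> 0" using assms by simp
  have "?z = complex_of_real (cmod ?z) * cis (Arg ?z)"
    using rcis_cmod_Arg[of ?z] by (simp only: rcis_def)
  then have "B - O' = complex_of_real (cmod ?z) * (cis (Arg ?z) * (A - O'))"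
    using assms by (simp add: field_simps)
  then show "- pi < Arg ?z \<and> Arg ?z \<le> pi \<and>
      (\<exists>r>0. B - O' = complex_of_real r * (cis (Arg ?z) * (A - O')))"
    using z Arg_bounded[of ?z] by (intro conjI exI[of _ "cmod ?z"]) auto
next
  fix t assume t: "- pi < t \<and> t \<le> pi \<and>
      (\<exists>r>0. B - O' = complex_of_real r * (cis t * (A - O')))"
  then obtain r where r: "r > 0" "B - O' = complex_of_real r * (cis t * (A - O'))" by blast
  then have "(B - O') / (A - O') = complex_of_real r * cis t"
    using assms by (simp add: field_simps)
  then have "sgn ((B - O') / (A - O')) = cis t"
    using r(1) by (simp add: sgn_eq norm_mult)
  from cis_Arg_unique[OF this] t show "t = Arg ((B - O') / (A - O'))" by simp
qed

text \<open>The definite description in \<^const>\<open>polygon_winding\<close> denotes as soon as no point of the list is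
  the centre.\<close>

lemma polygon_winding_spec:
  assumes "O' \<notin> set ps"
  shows "2 * pi * real_of_int (polygon_winding ps O') = total_angle ps O'"
proof -
  let ?n = "length ps"
  let ?d = "\<lambda>i. ps ! i - O'"
  let ?s = "\<lambda>i. Suc i mod ?n"
  have nz: "?d i \<noteq> 0" if "i < ?n" for i using assms that nth_mem by fastforce
  have "exp (\<i> * complex_of_real (total_angle ps O')) =
      (\<Prod>i<?n. cis (oriented_angle (ps ! i) O' (ps ! ?s i)))"
    by (simp add: total_angle_def sum_distrib_left exp_sum cis_conv_exp)
  also have "\<dots> = (\<Prod>i<?n. sgn (?d (?s i)) / sgn (?d i))"
  proof (rule prod.cong)
    fix i assume "i \<in> {..<?n}"
    then have i: "i < ?n" by simp
    then have "?s i < ?n" by (cases ?n) auto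
    with nz i have d: "?d (?s i) \<noteq> 0" "?d i \<noteq> 0" by blast+
    then have "oriented_angle (ps ! i) O' (ps ! ?s i) = Arg (?d (?s i) / ?d i)"
      by (intro oriented_angle_eq_Arg) auto
    moreover have "cis (Arg (?d (?s i) / ?d i)) = sgn (?d (?s i) / ?d i)"
      using d by (intro cis_Arg) simp
    ultimately show "cis (oriented_angle (ps ! i) O' (ps ! ?s i)) = sgn (?d (?s i)) / sgn (?d i)"
      by (simp only: sgn_divide)
  qed simp
  also have "\<dots> = (\<Prod>i<?n. sgn (?d (?s i))) / (\<Prod>i<?n. sgn (?d i))"
    by (rule prod_dividef)
  also have "(\<Prod>i<?n. sgn (?d (?s i))) = (\<Prod>i<?n. sgn (?d i))"
  proof (cases ?n)
    case (Suc m)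
    have "(\<Prod>i<Suc m. sgn (ps ! (Suc i mod Suc m) - O')) =
        (\<Prod>i<m. sgn (?d (Suc i))) * sgn (?d 0)"
      by simp
    also have "\<dots> = (\<Prod>i<Suc m. sgn (?d i))"
      by (simp only: prod.lessThan_Suc_shift mult.commute)
    finally show ?thesis using Suc by simp
  qed simp
  also have "(\<Prod>i<?n. sgn (?d i)) / (\<Prod>i<?n. sgn (?d i)) = 1"
    using nz by (intro divide_self) (simp add: sgn_zero_iff)
  finally have "exp (\<i> * complex_of_real (total_angle ps O')) = 1" .
  then obtain w :: int where "total_angle ps O' = of_int (2 * w) * pi"
    unfolding exp_eq_1 by auto
  then have w: "2 * pi * real_of_int w = total_angle ps O'" by simp
  have "w' = w" if "2 * pi * real_of_int w' = total_angle ps O'" for w' :: int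
  proof -
    have "2 * pi * real_of_int w' = 2 * pi * real_of_int w" using that w by (rule trans[OF _ sym])
    then show ?thesis by simp
  qed
  with w show ?thesis unfolding polygon_winding_def by (rule theI)
qed

definition K4_vertices :: "nat set" where
  "K4_vertices = {1, 2, 3, 4}"

text \<open>Oriented edges: each edge occurs in both orientations.\<close>

definition K4_edges :: "(nat \<times> nat) set" where
  "K4_edges = {(a, b). a \<in> K4_vertices \<and> b \<in> K4_vertices \<and> a \<noteq> b}"

record K4_map =
  vert :: "nat \<Rightarrow> complex"
  edge :: "nat \<Rightarrow> nat \<Rightarrow> complex list"

text \<open>Every edge consists of at least one (possibly degenerate) segment; a one-point list would
  have empty image.\<close>

definition pl_map :: "K4_map \<Rightarrow> bool" where
  "pl_map f \<longleftrightarrow> (\<forall>(a, b) \<in> K4_edges.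
     2 \<le> length (edge f a b) \<and> hd (edge f a b) = vert f a \<and> last (edge f a b) = vert f b \<and>
     edge f b a = rev (edge f a b))"

definition almost_embedding :: "K4_map \<Rightarrow> bool" where
  "almost_embedding f \<longleftrightarrow> pl_map f \<and>
     (\<forall>(a, b) \<in> K4_edges. \<forall>(c, d) \<in> K4_edges. {a, b} \<inter> {c, d} = {} \<longrightarrow>
        polyline_image (edge f a b) \<inter> polyline_image (edge f c d) = {})"

definition cycle_without :: "nat \<Rightarrow> nat list" where
  "cycle_without j = filter (\<lambda>i. i \<noteq> j) [1, 2, 3, 4]"

text \<open>Concatenation along a directed cycle. The last point of each edge is dropped, because it is
  the first point of the next one.\<close>

definition cycle_polygon :: "K4_map \<Rightarrow> nat list \<Rightarrow> complex list" where
  "cycle_polygon f c = concat (map (\<lambda>(a, b). butlast (edge f a b)) (zip c (rotate1 c)))"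

definition vertex_winding :: "K4_map \<Rightarrow> nat \<Rightarrow> int" where
  "vertex_winding f j = polygon_winding (cycle_polygon f (cycle_without j)) (vert f j)"

end

theory Submission
  imports Defs
begin

text \<open>Place the vertices 1, 3 at \<open>1, -1\<close> and 2, 4 at \<open>-R, R\<close> on the real axis. The edge 12
  is a spiral with \<open>n\<close> and a half turns about the origin, and 34 follows the opposite spiral; since
  the two are disjoint, the number of turns freely changes \<open>n\<^sub>1\<close> and \<open>n\<^sub>3\<close> together. In addition, an
  edge \<open>ab\<close> may make any number of extra loops along a circle (in the taxicab norm) of radius \<open>2R\<close>
  around everything, which keeps it disjoint from the opposite edge \<open>cd\<close>: loops of 34 change \<open>n\<^sub>1\<close>
  and \<open>n\<^sub>2\<close>, loops of 23 change \<open>n\<^sub>1\<close> and \<open>n\<^sub>4\<close>, loops of 24 change \<open>n\<^sub>1\<close> and \<open>n\<^sub>3\<close> in opposite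
  directions. Loops alone preserve \<open>n\<^sub>1 - n\<^sub>2 + n\<^sub>3 - n\<^sub>4\<close>; this is why the spirals are needed.\<close>

subsection \<open>Winding numbers as crossing numbers\<close>

text \<open>Signed crossing of the segment \<open>AB\<close> with the negative real axis; the sign condition on
  \<open>Re A * Im B - Re B * Im A\<close> says that the segment meets the real axis on the left of the origin.\<close>

definition crossing :: "complex \<Rightarrow> complex \<Rightarrow> int" where
  "crossing A B =
     (if 0 \<le> Im A \<and> Im B < 0 \<and> Re B * Im A < Re A * Im B then 1
      else if Im A < 0 \<and> 0 \<le> Im B \<and> Re A * Im B < Re B * Im A then - 1
      else 0)"

text \<open>No closing segment is added: the count runs along an open line, so the edges of a cycle
  can be counted separately and added.\<close>

fun crossings :: "complex \<Rightarrow> complex list \<Rightarrow> int" where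
  "crossings O' (a # b # ps) = crossing (a - O') (b - O') + crossings O' (b # ps)"
| "crossings O' _ = 0"

lemma crossing_swap: "crossing B A = - crossing A B"
  by (auto simp: crossing_def)

text \<open>\<open>Arg\<close> jumps by \<open>2 * pi\<close> across the negative real axis, and
  \<open>crossing\<close> records the jump. Counting \<open>Im = 0\<close> as the upper side matches
  the value \<open>pi\<close> of \<open>Arg\<close> on that axis.\<close>

lemma Arg_divide_eq_crossing:
  assumes "0 \<notin> closed_segment A B"
  shows "Arg (B / A) = Arg B - Arg A + 2 * pi * real_of_int (crossing A B)"
proof -
  have nz: "A \<noteq> 0" "B \<noteq> 0" using assms by auto
  define r s \<theta> \<phi> where "r = cmod A" and "s = cmod B" and "\<theta> = Arg A" and "\<phi> = Arg B"
  have pos: "r > 0" "s > 0" using nz by (auto simp: r_def s_def)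
  have A: "A = rcis r \<theta>" and B: "B = rcis s \<phi>"
    by (simp_all add: r_def s_def \<theta>_def \<phi>_def rcis_cmod_Arg)
  have bounds: "- pi < \<theta>" "\<theta> \<le> pi" "- pi < \<phi>" "\<phi> \<le> pi"
    using Arg_bounded[of A] Arg_bounded[of B] by (auto simp: \<theta>_def \<phi>_def)
  have ImA: "0 \<le> Im A \<longleftrightarrow> 0 \<le> \<theta>" and ImB: "0 \<le> Im B \<longleftrightarrow> 0 \<le> \<phi>"
  proof -
    have aux: "0 \<le> sin x \<longleftrightarrow> 0 \<le> x" if "- pi < x" "x \<le> pi" for x
      using that sin_ge_zero[of x] sin_gt_zero[of "- x"] by (cases "0 \<le> x") auto
    show "0 \<le> Im A \<longleftrightarrow> 0 \<le> \<theta>" "0 \<le> Im B \<longleftrightarrow> 0 \<le> \<phi>"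
      using pos bounds by (auto simp: A B rcis_def cis.sel zero_le_mult_iff aux)
  qed
  \<comment> \<open>For \<open>A\<close> and \<open>B\<close> on different sides of the real axis,
    the sign of this cross product tells whether their arguments differ by more than
    \<open>pi\<close>.\<close>
  have cross: "Re A * Im B - Re B * Im A = r * s * sin (\<phi> - \<theta>)"
    by (simp add: A B rcis_def sin_diff algebra_simps)
  have no_opp: "\<phi> - \<theta> \<noteq> - pi" "\<phi> - \<theta> \<noteq> pi"
  proof -
    \<comment> \<open>Opposite directions would make 0 the convex combination with weight
      \<open>r / (r + s)\<close> on \<open>B\<close>.\<close>
    have "B \<noteq> of_real (- (s / r)) * A"
    proof
      assume eq: "B = of_real (- (s / r)) * A"
      have "0 = (1 - r / (r + s)) *\<^sub>R A + (r / (r + s)) *\<^sub>R B"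
        using pos by (simp add: eq scaleR_conv_of_real field_simps)
      moreover have "0 \<le> r / (r + s)" "r / (r + s) \<le> 1" using pos by auto
      ultimately have "0 \<in> closed_segment A B" unfolding in_segment by blast
      with assms show False by simp
    qed
    moreover have "B = of_real (- (s / r)) * A" if "cis \<phi> = - cis \<theta>"
      using pos that by (simp add: A B rcis_def)
    moreover have "cis \<phi> = - cis \<theta>" if "\<phi> - \<theta> = - pi"
    proof -
      have "\<phi> = \<theta> + (- pi)" using that by simp
      then have "cis \<phi> = cis \<theta> * cis (- pi)" by (simp only: cis_mult)
      then show ?thesis by (simp add: complex_eq_iff)
    qed
    moreover have "cis \<phi> = - cis \<theta>" if "\<phi> - \<theta> = pi"
    proof -
      have "\<phi> = \<theta> + pi" using that by simp
      then have "cis \<phi> = cis \<theta> * cis pi" by (simp only: cis_mult)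
      then show ?thesis by (simp add: complex_eq_iff)
    qed
    ultimately show "\<phi> - \<theta> \<noteq> - pi" "\<phi> - \<theta> \<noteq> pi" by blast+
  qed
  \<comment> \<open>This is an argument of \<open>B / A\<close> in any case; only its range has to
    be checked.\<close>
  define t where "t = \<phi> - \<theta> + 2 * pi * real_of_int (crossing A B)"
  have "- pi < t \<and> t \<le> pi"
  proof (cases "0 \<le> \<theta>"; cases "0 \<le> \<phi>")
    assume *: "0 \<le> \<theta>" "0 \<le> \<phi>"
    then have "crossing A B = 0" using ImA ImB by (simp add: crossing_def)
    with * bounds no_opp show ?thesis by (simp add: t_def)
  next
    assume *: "\<not> 0 \<le> \<theta>" "\<not> 0 \<le> \<phi>"
    then have "crossing A B = 0" using ImA ImB by (simp add: crossing_def)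
    with * bounds no_opp show ?thesis by (simp add: t_def)
  next
    assume *: "0 \<le> \<theta>" "\<not> 0 \<le> \<phi>"
    show ?thesis
    proof (cases "\<phi> - \<theta> < - pi")
      case True
      then have "0 < sin (\<phi> - \<theta> + 2 * pi)"
        using bounds * by (intro sin_gt_zero) auto
      then have "0 < sin (\<phi> - \<theta>)" by (simp only: sin_periodic)
      then have "0 < r * s * sin (\<phi> - \<theta>)" using pos by simp
      then have "Re B * Im A < Re A * Im B" using cross by linarith
      then have "crossing A B = 1" using * ImA ImB by (simp add: crossing_def)
      with True * bounds show ?thesis by (simp add: t_def)
    next
      case False
      then have "0 < sin (- (\<phi> - \<theta>))"
        using bounds * no_opp by (intro sin_gt_zero) auto
      then have "sin (\<phi> - \<theta>) < 0" by (simp only: sin_minus neg_0_less_iff_less)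
      then have "r * s * sin (\<phi> - \<theta>) < 0" using pos by (simp add: mult_pos_neg)
      then have "crossing A B = 0" using * ImA ImB cross by (simp add: crossing_def)
      with False * bounds no_opp show ?thesis by (simp add: t_def)
    qed
  next
    assume *: "\<not> 0 \<le> \<theta>" "0 \<le> \<phi>"
    show ?thesis
    proof (cases "\<phi> - \<theta> > pi")
      case True
      then have "0 < sin (\<theta> - \<phi> + 2 * pi)"
        using bounds * by (intro sin_gt_zero) auto
      then have "0 < sin (- (\<phi> - \<theta>))" by (simp only: sin_periodic minus_diff_eq)
      then have "sin (\<phi> - \<theta>) < 0" by (simp only: sin_minus neg_0_less_iff_less)
      then have "r * s * sin (\<phi> - \<theta>) < 0" using pos by (simp add: mult_pos_neg)
      then have "crossing A B = - 1" using * ImA ImB cross by (simp add: crossing_def)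
      with True * bounds show ?thesis by (simp add: t_def)
    next
      case False
      then have "0 < sin (\<phi> - \<theta>)"
        using bounds * no_opp by (intro sin_gt_zero) auto
      then have "r * s * sin (\<phi> - \<theta>) > 0" using pos by simp
      then have "crossing A B = 0" using * ImA ImB cross by (simp add: crossing_def)
      with False * bounds no_opp show ?thesis by (simp add: t_def)
    qed
  qed
  moreover have "sgn (B / A) = cis t"
  proof -
    have "cis t = cis (\<phi> - \<theta>) * cis (2 * pi * real_of_int (crossing A B))"
      by (simp only: t_def cis_mult)
    also have "\<dots> = cis \<phi> / cis \<theta>"
      by (simp add: cis_divide cis_multiple_2pi)
    also have "\<dots> = sgn B / sgn A"
      using nz by (simp add: \<phi>_def \<theta>_def cis_Arg)
    finally show ?thesis by (simp add: sgn_divide)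
  qed
  ultimately have "Arg (B / A) = t" by (intro cis_Arg_unique) auto
  then show ?thesis by (simp add: t_def \<phi>_def \<theta>_def)
qed

section \<open>Concatenation and reversal of polygonal lines\<close>

lemma crossings_append:
  assumes "xs \<noteq> []" "ys \<noteq> []"
  shows "crossings O' (xs @ ys) =
    crossings O' xs + crossing (last xs - O') (hd ys - O') + crossings O' ys"
  using assms by (induction O' xs rule: crossings.induct) (auto simp: neq_Nil_conv)

lemma crossings_join:
  assumes "xs \<noteq> []" "ys \<noteq> []" "last xs = hd ys"
  shows "crossings O' (butlast xs @ ys) = crossings O' xs + crossings O' ys"
proof (cases "butlast xs = []")
  case True
  with assms(1) obtain a where "xs = [a]" by (cases xs rule: rev_cases) auto
  then show ?thesis by simp
next
  case False
  have "crossings O' xs = crossings O' (butlast xs @ [last xs])" using assms(1) by simp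
  with False assms show ?thesis by (simp add: crossings_append del: append_butlast_last_id)
qed

lemma crossings_rev: "crossings O' (rev ps) = - crossings O' ps"
proof (induction O' ps rule: crossings.induct)
  case (1 O' a b ps)
  have "crossings O' (rev (b # ps) @ [a]) = crossings O' (rev (b # ps)) + crossing (b - O') (a - O')"
    by (subst crossings_append) (auto simp del: rev.simps simp: last_rev)
  with 1 show ?case by (simp add: crossing_swap[of "b - O'"])
qed auto

lemma crossings_map_upt:
  "crossings O' (map g [0..<Suc N]) = (\<Sum>j<N. crossing (g j - O') (g (Suc j) - O'))"
proof (induction N)
  case (Suc N)
  have "crossings O' (map g [0..<Suc (Suc N)]) = crossings O' (map g [0..<Suc N] @ [g (Suc N)])"
    by simp
  also have "\<dots> = crossings O' (map g [0..<Suc N]) + crossing (g N - O') (g (Suc N) - O')"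
    by (subst crossings_append) auto
  finally show ?case using Suc by simp
qed simp

lemma crossings_Cons:
  "ps \<noteq> [] \<Longrightarrow> crossings O' (a # ps) = crossing (a - O') (hd ps - O') + crossings O' ps"
  by (cases ps) auto

lemma polyline_image_Cons [simp]:
  assumes "qs \<noteq> []"
  shows "polyline_image (a # qs) = closed_segment a (hd qs) \<union> polyline_image qs"
proof -
  obtain b ps where qs: "qs = b # ps" using assms by (cases qs) auto
  have "polyline_image (a # b # ps) =
      (\<Union>i\<in>insert 0 (Suc ` {..<length ps}). closed_segment ((a # b # ps) ! i) ((b # ps) ! i))"
    unfolding polyline_image_def by (simp add: lessThan_Suc_eq_insert_0)
  then show ?thesis unfolding polyline_image_def qs by simp
qed

lemma polyline_image_trivial [simp]: "polyline_image [] = {}" "polyline_image [a] = {}"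
  by (simp_all add: polyline_image_def)

lemma polyline_image_append:
  assumes "xs \<noteq> []" "ys \<noteq> []"
  shows "polyline_image (xs @ ys) =
    polyline_image xs \<union> closed_segment (last xs) (hd ys) \<union> polyline_image ys"
  using assms by (induction xs rule: induct_list012) (auto simp: neq_Nil_conv)

lemma polyline_image_join:
  assumes "xs \<noteq> []" "ys \<noteq> []" "last xs = hd ys"
  shows "polyline_image (butlast xs @ ys) = polyline_image xs \<union> polyline_image ys"
proof (cases "butlast xs = []")
  case True
  with assms(1) obtain a where "xs = [a]" by (cases xs rule: rev_cases) auto
  then show ?thesis by simp
next
  case False
  have "polyline_image xs = polyline_image (butlast xs @ [last xs])" using assms(1) by simp
  with False assms show ?thesis
    by (simp add: polyline_image_append del: append_butlast_last_id)
qed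

lemma polyline_image_rev [simp]: "polyline_image (rev ps) = polyline_image ps"
proof (induction ps rule: induct_list012)
  case (3 a b ps)
  have "polyline_image (rev (b # ps) @ [a]) = polyline_image (rev (b # ps)) \<union> closed_segment b a"
    by (subst polyline_image_append) (auto simp del: rev.simps simp: last_rev)
  with 3 show ?case by (simp add: closed_segment_commute Un_commute)
qed auto

lemma polyline_image_map_upt:
  "polyline_image (map g [0..<Suc N]) = (\<Union>j<N. closed_segment (g j) (g (Suc j)))"
  unfolding polyline_image_def by (auto simp del: upt_Suc)

lemma hd_last_in_polyline_image:
  assumes "2 \<le> length ps"
  shows "hd ps \<in> polyline_image ps" "last ps \<in> polyline_image ps"
proof -
  have hd: "hd qs \<in> polyline_image qs" if "2 \<le> length qs" for qs :: "complex list"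
    using that by (induction qs rule: induct_list012) auto
  from hd[OF assms] show "hd ps \<in> polyline_image ps" .
  from hd[of "rev ps"] assms show "last ps \<in> polyline_image ps" by (simp add: hd_rev)
qed

section \<open>From angle sums to winding numbers\<close>

lemma sum_angles_eq_crossings:
  assumes "ps \<noteq> []" "O' \<notin> polyline_image ps"
  shows "(\<Sum>i<length ps - 1. oriented_angle (ps ! i) O' (ps ! Suc i)) =
    Arg (last ps - O') - Arg (hd ps - O') + 2 * pi * real_of_int (crossings O' ps)"
  using assms
proof (induction ps rule: induct_list012)
  case (3 a b ps)
  have seg: "O' \<notin> closed_segment a b" using 3 by simp
  then have "a \<noteq> O'" "b \<noteq> O'" by auto
  moreover have "0 \<notin> closed_segment (a - O') (b - O')"
    using seg closed_segment_translation[of "- O'" a b] by auto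
  ultimately have "oriented_angle a O' b =
      Arg (b - O') - Arg (a - O') + 2 * pi * real_of_int (crossing (a - O') (b - O'))"
    by (simp add: oriented_angle_eq_Arg Arg_divide_eq_crossing)
  moreover have "(\<Sum>i<length (a # b # ps) - 1.
        oriented_angle ((a # b # ps) ! i) O' ((a # b # ps) ! Suc i)) =
      oriented_angle a O' b +
      (\<Sum>i<length (b # ps) - 1. oriented_angle ((b # ps) ! i) O' ((b # ps) ! Suc i))"
    by (simp add: sum.lessThan_Suc_shift del: sum.lessThan_Suc)
  ultimately show ?case using 3 by (simp add: algebra_simps)
qed auto

text \<open>The \<open>Arg\<close> terms of successive segments telescope, and on a closed line the
  two remaining ones cancel.\<close>

lemma polygon_winding_eq_crossings:
  assumes "ps \<noteq> []" "O' \<notin> polyline_image (ps @ [hd ps])"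
  shows "polygon_winding ps O' = crossings O' (ps @ [hd ps])"
proof -
  let ?qs = "ps @ [hd ps]"
  have "total_angle ps O' = (\<Sum>i<length ?qs - 1. oriented_angle (?qs ! i) O' (?qs ! Suc i))"
    unfolding total_angle_def
  proof (rule sum.cong)
    fix i assume "i \<in> {..<length ?qs - 1}"
    then have i: "i < length ps" by simp
    then have "ps ! (Suc i mod length ps) = ?qs ! Suc i"
      using assms(1) by (cases "Suc i = length ps") (auto simp: nth_append hd_conv_nth)
    with i show "oriented_angle (ps ! i) O' (ps ! (Suc i mod length ps)) =
        oriented_angle (?qs ! i) O' (?qs ! Suc i)"
      by (simp add: nth_append)
  qed simp
  also have "\<dots> = 2 * pi * real_of_int (crossings O' ?qs)"
    using assms by (subst sum_angles_eq_crossings) auto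
  finally have "total_angle ps O' = 2 * pi * real_of_int (crossings O' ?qs)" .
  then show ?thesis unfolding polygon_winding_def by simp
qed

subsection \<open>Maps of \<open>K\<^sub>4\<close> given by six polygonal lines\<close>

text \<open>Each edge is given in increasing direction only and reversed otherwise. Vertices are
  read off from end points, so compatibility becomes equations between the six lists.\<close>

definition K4_from ::
  "complex list \<Rightarrow> complex list \<Rightarrow> complex list \<Rightarrow> complex list \<Rightarrow> complex list \<Rightarrow> complex list \<Rightarrow> K4_map"
where
  "K4_from e12 e13 e14 e23 e24 e34 =
    (let e = (\<lambda>a b. if a = 1 then (if b = 2 then e12 else if b = 3 then e13 else e14)
                else if a = 2 then (if b = 3 then e23 else e24) else e34)
     in \<lparr>vert = (\<lambda>v. if v = 1 then hd e12 else if v = 2 then hd e23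
                       else if v = 3 then hd e34 else last e34),
         edge = (\<lambda>a b. if a < b then e a b else rev (e b a))\<rparr>)"

lemma polygon_winding_triangle:
  assumes "2 \<le> length e" "2 \<le> length e'" "2 \<le> length e''"
    and "last e = hd e'" "last e' = hd e''" "last e'' = hd e"
    and "O' \<notin> polyline_image e" "O' \<notin> polyline_image e'" "O' \<notin> polyline_image e''"
  shows "polygon_winding (butlast e @ butlast e' @ butlast e'') O' =
    crossings O' e + crossings O' e' + crossings O' e''"
proof -
  let ?ps = "butlast e @ butlast e' @ butlast e''"
  have ne: "e \<noteq> []" "e' \<noteq> []" "e'' \<noteq> []" "butlast e \<noteq> []" "butlast e' \<noteq> []"
    using assms(1-3) by (auto simp: butlast_conv_take)
  have "hd ?ps = last e''"
    using ne assms(6) by (cases e) (auto split: if_splits)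
  \<comment> \<open>Closing the polygon restores the end point that the last \<open>butlast\<close>
    removed.\<close>
  then have ps: "?ps @ [hd ?ps] = butlast e @ (butlast e' @ e'')" using ne by simp
  have h: "hd (butlast e' @ e'') = hd e'"
    using ne by (cases e') (auto split: if_splits)
  have "polyline_image (?ps @ [hd ?ps]) = polyline_image e \<union> (polyline_image e' \<union> polyline_image e'')"
    unfolding ps using ne assms(4,5) h by (simp add: polyline_image_join)
  moreover have "crossings O' (?ps @ [hd ?ps]) = crossings O' e + (crossings O' e' + crossings O' e'')"
    unfolding ps using ne assms(4,5) h by (simp add: crossings_join)
  ultimately show ?thesis
    using assms(7-9) ne by (subst polygon_winding_eq_crossings) auto
qed

text \<open>In a cycle \<open>abc\<close> with \<open>a < b < c\<close>, the edge from
  \<open>c\<close> to \<open>a\<close> runs against its stored direction; hence the minus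
  signs.\<close>

lemma K4_from_almost_embedding:
  assumes len: "\<forall>e \<in> {e12, e13, e14, e23, e24, e34}. 2 \<le> length e"
    and V1: "hd e12 = V1" "hd e13 = V1" "hd e14 = V1"
    and V2: "last e12 = V2" "hd e23 = V2" "hd e24 = V2"
    and V3: "last e13 = V3" "last e23 = V3" "hd e34 = V3"
    and V4: "last e14 = V4" "last e24 = V4" "last e34 = V4"
    and disj: "polyline_image e12 \<inter> polyline_image e34 = {}"
      "polyline_image e13 \<inter> polyline_image e24 = {}"
      "polyline_image e14 \<inter> polyline_image e23 = {}"
  defines "f \<equiv> K4_from e12 e13 e14 e23 e24 e34"
  shows "almost_embedding f"
    and "vertex_winding f 1 = crossings V1 e23 + crossings V1 e34 - crossings V1 e24"
    and "vertex_winding f 2 = crossings V2 e13 + crossings V2 e34 - crossings V2 e14"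
    and "vertex_winding f 3 = crossings V3 e12 + crossings V3 e24 - crossings V3 e14"
    and "vertex_winding f 4 = crossings V4 e12 + crossings V4 e23 - crossings V4 e13"
proof -
  have len': "2 \<le> length e12" "2 \<le> length e13" "2 \<le> length e14"
      "2 \<le> length e23" "2 \<le> length e24" "2 \<le> length e34"
    using len by auto
  have edge: "edge f 1 2 = e12" "edge f 1 3 = e13" "edge f 1 4 = e14" "edge f 2 3 = e23"
      "edge f 2 4 = e24" "edge f 3 4 = e34" "edge f 2 1 = rev e12" "edge f 3 1 = rev e13"
      "edge f 4 1 = rev e14" "edge f 3 2 = rev e23" "edge f 4 2 = rev e24" "edge f 4 3 = rev e34"
    and vert: "vert f 1 = V1" "vert f 2 = V2" "vert f 3 = V3" "vert f 4 = V4"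
    using V1 V2 V3 V4 by (simp_all add: f_def K4_from_def Let_def)
  have edges: "K4_edges = {(1,2),(1,3),(1,4),(2,3),(2,4),(3,4),(2,1),(3,1),(4,1),(3,2),(4,2),(4,3)}"
    by (auto simp: K4_edges_def K4_vertices_def)
  have "pl_map f"
    unfolding pl_map_def edges using len' V1 V2 V3 V4
    by (simp add: edge[unfolded One_nat_def] edge vert[unfolded One_nat_def] vert hd_rev last_rev)
  moreover have "\<forall>(a, b) \<in> K4_edges. \<forall>(c, d) \<in> K4_edges. {a, b} \<inter> {c, d} = {} \<longrightarrow>
      polyline_image (edge f a b) \<inter> polyline_image (edge f c d) = {}"
    unfolding edges using disj
    by (simp add: edge[unfolded One_nat_def] edge Int_commute)
  ultimately show "almost_embedding f" by (simp add: almost_embedding_def)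
  \<comment> \<open>Every edge of the cycle omitting a vertex is disjoint from some edge at that
    vertex, so the vertex is off the cycle.\<close>
  have "V1 \<in> polyline_image e12" "V1 \<in> polyline_image e13" "V1 \<in> polyline_image e14"
    "V2 \<in> polyline_image e12" "V2 \<in> polyline_image e23" "V2 \<in> polyline_image e24"
    "V3 \<in> polyline_image e13" "V3 \<in> polyline_image e23" "V3 \<in> polyline_image e34"
    "V4 \<in> polyline_image e14" "V4 \<in> polyline_image e24" "V4 \<in> polyline_image e34"
    using len'[THEN hd_last_in_polyline_image(1)] len'[THEN hd_last_in_polyline_image(2)]
    by (simp_all add: V1 V2 V3 V4)
  with disj have out: "V1 \<notin> polyline_image e23" "V1 \<notin> polyline_image e24" "V1 \<notin> polyline_image e34"
    "V2 \<notin> polyline_image e13" "V2 \<notin> polyline_image e14" "V2 \<notin> polyline_image e34"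
    "V3 \<notin> polyline_image e12" "V3 \<notin> polyline_image e14" "V3 \<notin> polyline_image e24"
    "V4 \<notin> polyline_image e12" "V4 \<notin> polyline_image e13" "V4 \<notin> polyline_image e23"
    by blast+
  have ne: "e12 \<noteq> []" "e13 \<noteq> []" "e14 \<noteq> []" "e23 \<noteq> []" "e24 \<noteq> []" "e34 \<noteq> []"
    using len' by auto
  note defs = vertex_winding_def cycle_polygon_def cycle_without_def
    edge[unfolded One_nat_def] edge vert[unfolded One_nat_def] vert
  note facts = len' ne V1 V2 V3 V4 out
  show "vertex_winding f 1 = crossings V1 e23 + crossings V1 e34 - crossings V1 e24"
    using facts polygon_winding_triangle[of e23 e34 "rev e24" V1]
    by (simp add: defs hd_rev last_rev crossings_rev)
  show "vertex_winding f 2 = crossings V2 e13 + crossings V2 e34 - crossings V2 e14"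
    using facts polygon_winding_triangle[of e13 e34 "rev e14" V2]
    by (simp add: defs hd_rev last_rev crossings_rev)
  show "vertex_winding f 3 = crossings V3 e12 + crossings V3 e24 - crossings V3 e14"
    using facts polygon_winding_triangle[of e12 e24 "rev e14" V3]
    by (simp add: defs hd_rev last_rev crossings_rev)
  show "vertex_winding f 4 = crossings V4 e12 + crossings V4 e23 - crossings V4 e13"
    using facts polygon_winding_triangle[of e12 e23 "rev e13" V4]
    by (simp add: defs hd_rev last_rev crossings_rev)
qed

subsection \<open>Spirals and loops\<close>

text \<open>A spiral of \<open>N\<close> quarter turns starting at \<open>x\<close>: counterclockwise if \<open>b > 0\<close>, clockwise if
  \<open>b < 0\<close>, with the distance from the origin multiplied by \<open>\<bar>b\<bar>\<close> at each vertex.\<close>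

definition turn :: "real \<Rightarrow> real \<Rightarrow> nat \<Rightarrow> complex list" where
  "turn b x N = map (\<lambda>j. of_real x * (of_real b * \<i>) ^ j) [0..<Suc N]"

text \<open>With ratio 1 or -1 four quarter turns close up to one lap, clockwise for negative
  \<open>k\<close>. For \<open>k = 0\<close> the list is the single point \<open>x\<close>.\<close>

definition loops :: "int \<Rightarrow> real \<Rightarrow> complex list" where
  "loops k x = turn (if 0 \<le> k then 1 else - 1) x (4 * nat \<bar>k\<bar>)"

text \<open>On a segment between points of two adjacent half-axes this norm is affine, hence
  constant along loops and strictly increasing along spirals of ratio 2.\<close>

definition taxicab :: "complex \<Rightarrow> real" where
  "taxicab z = \<bar>Re z\<bar> + \<bar>Im z\<bar>"

lemma turn_nonempty [simp]: "turn b x N \<noteq> []"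
  and length_turn [simp]: "length (turn b x N) = Suc N"
  and hd_turn [simp]: "hd (turn b x N) = of_real x"
  and last_turn [simp]: "last (turn b x N) = of_real x * (of_real b * \<i>) ^ N"
  by (simp_all add: turn_def hd_map last_map del: upt_Suc)

section \<open>Crossing numbers of spirals and loops\<close>

lemma imaginary_power_even:
  "(of_real b * \<i>) ^ (2 * j) = complex_of_real ((- (b\<^sup>2)) ^ j)"
  by (simp add: power_mult power_mult_distrib)

text \<open>A half turn above the axis counts nothing, as real points belong to the upper side. One
  below leaves that side at \<open>x\<close> and returns at \<open>x'\<close>; each event counts
  only when left of \<open>o'\<close>.\<close>

lemma crossings_half_turn:
  assumes "y \<noteq> 0" "x \<noteq> o'" "x' \<noteq> o'"
  shows "crossing (of_real x - of_real o') (of_real y * \<i> - of_real o') +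
      crossing (of_real y * \<i> - of_real o') (of_real x' - of_real o') =
    (if 0 < y then 0 else of_bool (x < o') - of_bool (x' < o'))"
  using assms by (auto simp: crossing_def zero_less_mult_iff)

text \<open>Quarter turns are paired into half turns: vertices of even index are real, those of odd
  index imaginary.\<close>

lemma crossings_turn:
  assumes "b \<noteq> 0" "x \<noteq> 0" "\<And>j. j \<le> N \<Longrightarrow> x * (- (b\<^sup>2)) ^ j \<noteq> o'"
  shows "crossings (of_real o') (turn b x (2 * N)) =
    (\<Sum>j<N. if 0 < b * (x * (- (b\<^sup>2)) ^ j) then 0
       else of_bool (x * (- (b\<^sup>2)) ^ j < o') - of_bool (x * (- (b\<^sup>2)) ^ Suc j < o'))"
proof -
  define g where "g = (\<lambda>j. of_real x * (of_real b * \<i>) ^ j - complex_of_real o')"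
  define r where "r = (\<lambda>j. x * (- (b\<^sup>2)) ^ j)"
  have even: "g (2 * j) = of_real (r j) - of_real o'" for j
    by (simp only: g_def r_def imaginary_power_even of_real_mult)
  have odd: "g (Suc (2 * j)) = of_real (b * r j) * \<i> - of_real o'" for j
    unfolding g_def r_def power_Suc imaginary_power_even by simp
  have "crossings (of_real o') (turn b x (2 * N)) = (\<Sum>j<2 * N. crossing (g j) (g (Suc j)))"
    unfolding turn_def g_def by (rule crossings_map_upt)
  also have "\<dots> = (\<Sum>j<N. crossing (g (2 * j)) (g (Suc (2 * j))) +
      crossing (g (Suc (2 * j))) (g (2 * Suc j)))"
    by (induction N) simp_all
  also have "\<dots> = (\<Sum>j<N. if 0 < b * r j then 0 else of_bool (r j < o') - of_bool (r (Suc j) < o'))"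
  proof (rule sum.cong)
    fix j assume "j \<in> {..<N}"
    then have "r j \<noteq> o'" "r (Suc j) \<noteq> o'" using assms(3) by (simp_all add: r_def del: power_Suc)
    moreover have "b * r j \<noteq> 0" using assms by (simp add: r_def)
    ultimately show "crossing (g (2 * j)) (g (Suc (2 * j))) + crossing (g (Suc (2 * j))) (g (2 * Suc j)) =
        (if 0 < b * r j then 0 else of_bool (r j < o') - of_bool (r (Suc j) < o'))"
      unfolding even odd by (intro crossings_half_turn)
  qed simp
  finally show ?thesis by (simp only: r_def)
qed

text \<open>With all real vertices on one side of \<open>o'\<close>, the two indicators of each half
  turn agree.\<close>

lemma crossings_turn_eq_0:
  assumes "b \<noteq> 0" "x \<noteq> 0"
    and "(\<forall>j\<le>N. x * (- (b\<^sup>2)) ^ j < o') \<or> (\<forall>j\<le>N. o' < x * (- (b\<^sup>2)) ^ j)"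
  shows "crossings (of_real o') (turn b x (2 * N)) = 0"
proof -
  have "x * (- (b\<^sup>2)) ^ j \<noteq> o'" if "j \<le> N" for j using assms(3) that by auto
  moreover have "(x * (- (b\<^sup>2)) ^ j < o') = (x * (- (b\<^sup>2)) ^ Suc j < o')" if "j < N" for j
    using assms(3) that by (metis Suc_leI less_imp_le not_less_iff_gr_or_eq)
  ultimately show ?thesis
    using assms(1,2) by (subst crossings_turn) (auto intro!: sum.neutral simp del: power_Suc)
qed

text \<open>Of the two half turns of each lap, the upper one counts 0 and the lower one gives the
  sign.\<close>

lemma crossings_loops:
  assumes "\<bar>o'\<bar> < \<bar>x\<bar>"
  shows "crossings (of_real o') (loops k x) = k"
proof -
  have *: "crossings (of_real o') (turn b x (4 * n)) = of_int s * int n"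
    if b: "b = of_int s" "s = 1 \<or> s = - 1" for b n s
  proof -
    have sq: "b\<^sup>2 = 1" using b by (auto simp: power2_eq_square)
    have ne: "x * (- (b\<^sup>2)) ^ j \<noteq> o'" for j
      using assms by (cases "even j") (auto simp: sq)
    have "crossings (of_real o') (turn b x (2 * (2 * n))) =
      (\<Sum>j<2 * n. if 0 < b * (x * (- (b\<^sup>2)) ^ j) then 0
         else of_bool (x * (- (b\<^sup>2)) ^ j < o') - of_bool (x * (- (b\<^sup>2)) ^ Suc j < o'))"
      using b assms ne by (intro crossings_turn) auto
    also have "\<dots> = s * int n"
      using b(2) assms unfolding sq
      by (induction n) (auto simp: b(1) algebra_simps)
    finally show ?thesis by simp
  qed
  show ?thesis
    using *[of 1 1 "nat \<bar>k\<bar>"] *[of "- 1" "- 1" "nat \<bar>k\<bar>"] by (auto simp: loops_def)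
qed

lemma loops_nonempty [simp]: "loops k x \<noteq> []"
  and hd_loops [simp]: "hd (loops k x) = of_real x"
  and last_loops [simp]: "last (loops k x) = of_real x"
proof -
  have "(of_real b * \<i>) ^ (4 * m) = 1" if "b\<^sup>2 = 1" for b m
    using imaginary_power_even[of b "2 * m"] that by simp
  then show "last (loops k x) = of_real x" by (simp add: loops_def del: of_real_minus)
qed (simp_all add: loops_def)

lemma minus_four_power: "(- 4 :: real) ^ j = (if even j then 4 ^ j else - (4 ^ j))"
  by (simp add: power_minus[of 4])

text \<open>The \<open>4 * n + 2\<close> quarter turns are \<open>n\<close> full turns and a half.
  Opposite spirals put that extra half on different sides of the axis, so their two counts at the
  inner vertices differ by 1: the source of the odd sum.\<close>

lemma crossings_spiral:
  assumes "b = 2 \<or> b = - 2"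
  shows "crossings (- 1) (turn b 1 (4 * n + 2)) = (if b = 2 then int n else - int n - 1)"
    and "crossings 1 (turn b (- 1) (4 * n + 2)) = (if b = 2 then int n + 1 else - int n)"
    and "crossings (of_real (4 * 16 ^ n)) (turn b 1 (4 * n + 2)) = 0"
    and "crossings (of_real (- 4 * 16 ^ n)) (turn b (- 1) (4 * n + 2)) = 0"
proof -
  have N: "4 * n + 2 = 2 * (2 * n + 1)" by simp
  have sq: "b\<^sup>2 = 4" using assms by auto
  have b0: "b \<noteq> 0" using assms by auto
  have ge: "1 \<le> (4::real) ^ j" for j by simp
  have ne: "1 * (- (b\<^sup>2)) ^ j \<noteq> - 1" "- 1 * (- (b\<^sup>2)) ^ j \<noteq> 1" for j
    using one_less_power[of "4::real" j] ge[of j] unfolding sq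
    by (cases "j = 0"; auto simp: minus_four_power)+
  have even: "(- 4 :: real) ^ (2 * m) = 16 ^ m" for m by (simp add: power_mult)
  have ge': "1 \<le> (16::real) ^ m" "1 < 4 * (16::real) ^ m" for m
    using one_le_power[of "16::real" m] by linarith+
  have "crossings (of_real (- 1)) (turn b 1 (4 * n + 2)) = (if b = 2 then int n else - int n - 1)"
    unfolding N
  proof (subst crossings_turn)
    show "(\<Sum>j<2 * n + 1. if 0 < b * (1 * (- (b\<^sup>2)) ^ j) then 0
         else of_bool (1 * (- (b\<^sup>2)) ^ j < - 1) - of_bool (1 * (- (b\<^sup>2)) ^ Suc j < - 1)) =
       (if b = 2 then int n else - int n - 1)"
      unfolding sq using assms
    \<comment> \<open>The base case is the first half turn; each step adds a full turn, of which
      only the lower half contributes.\<close>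
    proof (induction n)
      case (Suc n)
      then show ?case using ge'[of n] by (auto simp: even minus_four_power power_mult)
    qed auto
  qed (use b0 ne in auto)
  then show "crossings (- 1) (turn b 1 (4 * n + 2)) = (if b = 2 then int n else - int n - 1)"
    by simp
  have "crossings (of_real 1) (turn b (- 1) (4 * n + 2)) = (if b = 2 then int n + 1 else - int n)"
    unfolding N
  proof (subst crossings_turn)
    show "(\<Sum>j<2 * n + 1. if 0 < b * (- 1 * (- (b\<^sup>2)) ^ j) then 0
         else of_bool (- 1 * (- (b\<^sup>2)) ^ j < 1) - of_bool (- 1 * (- (b\<^sup>2)) ^ Suc j < 1)) =
       (if b = 2 then int n + 1 else - int n)"
      unfolding sq using assms
    proof (induction n)
      case (Suc n)
      then show ?case using ge'[of n] by (auto simp: even minus_four_power power_mult)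
    qed auto
  qed (use b0 ne in auto)
  then show "crossings 1 (turn b (- 1) (4 * n + 2)) = (if b = 2 then int n + 1 else - int n)"
    by simp
  have lt: "(- (b\<^sup>2)) ^ j < 4 * 16 ^ n" if "j \<le> 2 * n + 1" for j
  proof (cases "even j")
    case True
    \<comment> \<open>The last index \<open>2 * n + 1\<close> is odd, so positive vertices are at
      most \<open>16 ^ n\<close>.\<close>
    with that have "j \<le> 2 * n" by (cases "j = 2 * n + 1") auto
    then have "(4::real) ^ j \<le> 4 ^ (2 * n)" by (intro power_increasing) auto
    then show ?thesis using ge'[of n] True by (simp add: sq minus_four_power power_mult)
  next
    case False
    have "- ((4::real) ^ j) < 4 * 16 ^ n" using ge'(2)[of n] ge[of j] by linarith
    with False show ?thesis by (simp add: sq minus_four_power)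
  qed
  show "crossings (of_real (4 * 16 ^ n)) (turn b 1 (4 * n + 2)) = 0"
    unfolding N using b0 lt by (intro crossings_turn_eq_0) auto
  show "crossings (of_real (- 4 * 16 ^ n)) (turn b (- 1) (4 * n + 2)) = 0"
    unfolding N using b0 lt by (intro crossings_turn_eq_0) auto
qed

section \<open>The taxicab norm and disjointness\<close>

lemma taxicab_turn:
  "taxicab (of_real x * (of_real b * \<i>) ^ j * w) = \<bar>x\<bar> * \<bar>b\<bar> ^ j * taxicab w"
proof -
  have "taxicab ((of_real b * \<i>) ^ j * w) = \<bar>b\<bar> ^ j * taxicab w"
  proof (induction j)
    case (Suc j)
    \<comment> \<open>Multiplication by \<open>\<i>\<close> exchanges the absolute values of real
      and imaginary part.\<close>
    have "taxicab (of_real b * \<i> * v) = \<bar>b\<bar> * taxicab v" for v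
      by (simp add: taxicab_def abs_mult algebra_simps)
    with Suc show ?case by (simp add: mult.assoc)
  qed simp
  moreover have "taxicab (of_real x * v) = \<bar>x\<bar> * taxicab v" for v
    by (simp add: taxicab_def abs_mult algebra_simps)
  ultimately show ?thesis by (simp add: mult.assoc)
qed

lemma polyline_image_turnE:
  assumes "z \<in> polyline_image (turn b x N)"
  obtains j t where "j < N" "0 \<le> t" "t \<le> 1"
    "z = of_real x * (of_real b * \<i>) ^ j * (1 - of_real t + of_real t * (of_real b * \<i>))"
    "taxicab z = \<bar>x\<bar> * \<bar>b\<bar> ^ j * (1 - t + t * \<bar>b\<bar>)"
proof -
  obtain j where j: "j < N"
    and "z \<in> closed_segment (of_real x * (of_real b * \<i>) ^ j) (of_real x * (of_real b * \<i>) ^ Suc j)"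
    using assms unfolding turn_def polyline_image_map_upt by (elim UN_E) simp
  then obtain t where t: "0 \<le> t" "t \<le> 1"
    and z: "z = (1 - t) *\<^sub>R (of_real x * (of_real b * \<i>) ^ j) +
      t *\<^sub>R (of_real x * (of_real b * \<i>) ^ Suc j)"
    unfolding in_segment by (elim exE conjE)
  have z': "z = of_real x * (of_real b * \<i>) ^ j * (1 - of_real t + of_real t * (of_real b * \<i>))"
    unfolding z by (simp add: scaleR_conv_of_real algebra_simps)
  have "taxicab (1 - of_real t + of_real t * (of_real b * \<i>)) = 1 - t + t * \<bar>b\<bar>"
    using t by (simp add: taxicab_def abs_mult)
  then have "taxicab z = \<bar>x\<bar> * \<bar>b\<bar> ^ j * (1 - t + t * \<bar>b\<bar>)"
    unfolding z' taxicab_turn by simp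
  with j t z' show thesis by (rule that)
qed

lemma taxicab_unit_turn:
  assumes "z \<in> polyline_image (turn b x N)" "\<bar>b\<bar> = 1"
  shows "taxicab z = \<bar>x\<bar>"
  using assms(1) by (rule polyline_image_turnE) (simp add: assms(2))

lemma taxicab_loops: "z \<in> polyline_image (loops k x) \<Longrightarrow> taxicab z = \<bar>x\<bar>"
  unfolding loops_def by (erule taxicab_unit_turn) simp

text \<open>The norm \<open>\<bar>x\<bar> * 2 ^ j * (1 + t)\<close> reaches
  \<open>\<bar>x\<bar> * 2 ^ N\<close> only on the last segment at \<open>t = 1\<close>, unless
  \<open>x = 0\<close>.\<close>

lemma spiral_boundary:
  assumes "z \<in> polyline_image (turn b x N)" "\<bar>b\<bar> = 2" "\<bar>x\<bar> * 2 ^ N \<le> taxicab z"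
  shows "z = of_real x * (of_real b * \<i>) ^ N"
  using assms(1)
proof (rule polyline_image_turnE)
  fix j t assume j: "j < N" and t: "0 \<le> t" "t \<le> 1"
    and z: "z = of_real x * (of_real b * \<i>) ^ j * (1 - of_real t + of_real t * (of_real b * \<i>))"
    and tz: "taxicab z = \<bar>x\<bar> * \<bar>b\<bar> ^ j * (1 - t + t * \<bar>b\<bar>)"
  show ?thesis
  proof (cases "x = 0")
    case True
    then show ?thesis using z by simp
  next
    case False
    with assms(2,3) tz have le: "(2::real) ^ N \<le> 2 ^ j * (t + 1)"
      by (simp add: mult.assoc)
    also have "\<dots> \<le> 2 ^ Suc j" using t by simp
    finally have "N \<le> Suc j" by (rule power_le_imp_le_exp[rotated]) simp
    with j have N: "N = Suc j" by simp
    with le t have "t = 1" by simp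
    then show ?thesis using z N by simp
  qed
qed

text \<open>On a spiral with ratio 2 the taxicab norm is strictly monotone along the line, so a point is
  determined by its norm. Hence a spiral is disjoint from its reflection in the origin.\<close>

lemma opposite_spirals_disjoint:
  assumes b: "\<bar>b\<bar> = 2"
  shows "polyline_image (turn b 1 N) \<inter> polyline_image (turn b (- 1) M) = {}"
proof -
  define c where "c = of_real b * \<i>"
  have neq: "v \<noteq> - v" if "v \<noteq> 0" for v :: complex
    using that by (auto simp: complex_eq_iff)
  have key: False
    if jk: "j \<le> k" and t: "t \<le> 1" and s: "0 \<le> s"
      and norms: "(2::real) ^ j * (1 + t) = 2 ^ k * (1 + s)"
      and v: "v = c ^ j * (1 - of_real t + of_real t * c)"
        "- v = c ^ k * (1 - of_real s + of_real s * c)"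
      and "v \<noteq> 0"
    for j k :: nat and s t :: real and v
  proof (cases "j = k")
    case True
    with norms have "t = s" by simp
    with v(1) True have "- v = v" using v(2) by (simp only:)
    with neq[OF \<open>v \<noteq> 0\<close>] show False by (rule notE[OF _ sym])
  next
    case False
    \<comment> \<open>Equal norms on different segments occur only at the common vertex of
      consecutive ones: \<open>d = 0\<close>, \<open>t = 1\<close>, \<open>s = 0\<close>.\<close>
    then obtain d where k: "k = Suc (j + d)" using jk less_imp_Suc_add[of j k] by auto
    have 1: "1 + t = 2 * 2 ^ d * (1 + s)"
      using norms unfolding k by (simp add: power_add)
    have "2 * 1 * (1 + s) \<le> 2 * 2 ^ d * (1 + s)"
      using s by (intro mult_right_mono mult_left_mono) auto
    then have "2 * (1 + s) \<le> 1 + t" by (simp only: 1 mult_1_right)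
    then have "t = 1" "s = 0" using t s by auto
    with 1 have "(2::real) ^ d = 1" by simp
    then have "d = 0" using one_less_power[of "2::real" d] by (cases "d = 0") auto
    with \<open>t = 1\<close> \<open>s = 0\<close> v have "v = c ^ j * c" "- v = c ^ j * c" by (simp_all add: k)
    then have "v = - v" by (rule trans[OF _ sym])
    with neq[OF \<open>v \<noteq> 0\<close>] show False by (rule notE)
  qed
  show ?thesis
  proof (rule equals0I)
    fix z assume "z \<in> polyline_image (turn b 1 N) \<inter> polyline_image (turn b (- 1) M)"
    then have z: "z \<in> polyline_image (turn b 1 N)" "z \<in> polyline_image (turn b (- 1) M)" by auto
    from z(1) obtain j t where t: "0 \<le> t" "t \<le> 1"
      and z1: "z = of_real 1 * c ^ j * (1 - of_real t + of_real t * c)"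
      and n1: "taxicab z = \<bar>1\<bar> * \<bar>b\<bar> ^ j * (1 - t + t * \<bar>b\<bar>)"
      unfolding c_def by (rule polyline_image_turnE)
    from z(2) obtain k s where s: "0 \<le> s" "s \<le> 1"
      and z2: "z = of_real (- 1) * c ^ k * (1 - of_real s + of_real s * c)"
      and n2: "taxicab z = \<bar>- 1\<bar> * \<bar>b\<bar> ^ k * (1 - s + s * \<bar>b\<bar>)"
      unfolding c_def by (rule polyline_image_turnE)
    have z1: "z = c ^ j * (1 - of_real t + of_real t * c)" using z1 by simp
    have z2: "- z = c ^ k * (1 - of_real s + of_real s * c)" using z2 by simp
    have norm1: "taxicab z = 2 ^ j * (1 + t)" using b by (simp add: n1)
    have norm2: "taxicab z = 2 ^ k * (1 + s)" using b by (simp add: n2)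
    have nz: "z \<noteq> 0" using norm1 t by (auto simp: taxicab_def)
    show False
    proof (cases "j \<le> k")
      case True
      show False
        by (rule key[OF True t(2) s(1) _ z1 z2 nz]) (simp only: flip: norm1 norm2)
    next
      case False
      then have kj: "k \<le> j" by simp
      \<comment> \<open>Exchanging the two spirals replaces \<open>z\<close> by
        \<open>- z\<close>.\<close>
      have z1': "- (- z) = c ^ j * (1 - of_real t + of_real t * c)" using z1 by simp
      have nz': "- z \<noteq> 0" using nz by simp
      show False
        by (rule key[OF kj s(2) t(1) _ z2 z1' nz']) (simp only: flip: norm1 norm2)
    qed
  qed
qed

subsection \<open>The construction\<close>

theorem theorem1p2:
  fixes n1 n2 n3 n4 :: int
  assumes "odd (n1 + n2 + n3 + n4)"
  shows "\<exists>f. almost_embedding f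
    \<and> vertex_winding f 1 = n1 \<and> vertex_winding f 2 = n2
    \<and> vertex_winding f 3 = n3 \<and> vertex_winding f 4 = n4"
proof -
  have "odd (n1 - n2 + n3 - n4)" using assms by simp
  \<comment> \<open>The spirals will count \<open>p\<close> at vertex 3 and \<open>p + 1\<close> at
    vertex 1; together they supply the alternating sum that loops cannot change.\<close>
  then obtain p where p: "n1 - n2 + n3 - n4 = 2 * p + 1" by (elim oddE)
  \<comment> \<open>The first half turn meets the ray only when clockwise, hence \<open>- p - 1\<close> below.\<close>
  define b :: real where "b = (if 0 \<le> p then 2 else - 2)"
  define n where "n = nat (if 0 \<le> p then p else - p - 1)"
  \<comment> \<open>This is \<open>2 ^ (4 * n + 2)\<close>, the norm at which both spirals
    end.\<close>
  define R :: real where "R = 4 * 16 ^ n"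
  have b: "b = 2 \<or> b = - 2" "\<bar>b\<bar> = 2" by (auto simp: b_def)
  have R: "R \<ge> 4" by (simp add: R_def)
  define e12 where "e12 = turn b 1 (4 * n + 2)"
  \<comment> \<open>The spiral ends at \<open>R\<close>; the line then goes out to
    \<open>2 * R\<close>, loops there and returns.\<close>
  define e34 where "e34 = turn b (- 1) (4 * n + 2) @ loops n2 (2 * R) @ [of_real R]"
  define e13 where "e13 = [1, - 1 :: complex]"
  define e14 where "e14 = [1, complex_of_real R]"
  \<comment> \<open>The way back from \<open>- 2 * R\<close> to vertex 3 passes straight through
    vertex 2, an end point of this edge.\<close>
  define e23 where "e23 = of_real (- R) # loops n4 (- 2 * R) @ [- 1]"
  \<comment> \<open>The \<open>- p\<close> offsets the spiral of 12 at vertex 3. The final half turn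
    passes above the axis from \<open>- 2 * R\<close> to \<open>2 * R\<close>.\<close>
  define e24 where "e24 = of_real (- R) # loops (n3 - p) (- 2 * R) @
    turn (- 1) (- 2 * R) 2 @ [of_real R]"
  have pow: "(of_real b * \<i>) ^ (4 * n + 2) = complex_of_real (- R)"
  proof -
    have "(- (b\<^sup>2)) ^ (2 * n + 1) = - R" using b(1) by (auto simp: R_def power_mult)
    then show ?thesis using imaginary_power_even[of b "2 * n + 1"] by simp
  qed
  have ends: "hd e12 = 1" "hd e13 = 1" "hd e14 = 1"
    "last e12 = of_real (- R)" "hd e23 = of_real (- R)" "hd e24 = of_real (- R)"
    "last e13 = - 1" "last e23 = - 1" "hd e34 = - 1"
    "last e14 = of_real R" "last e24 = of_real R" "last e34 = of_real R"
    using pow by (simp_all add: e12_def e13_def e14_def e23_def e24_def e34_def)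
  have real_seg: "Im z = 0 \<and> x \<le> Re z \<and> Re z \<le> y"
    if "z \<in> closed_segment (of_real x) (of_real y)" "x \<le> y" for z x y
    using that by (auto simp: closed_segment_of_real closed_segment_eq_real_ivl)

  \<comment> \<open>Disjointness of non-adjacent edges\<close>
  have disj1: "polyline_image e12 \<inter> polyline_image e34 = {}"
  proof (rule equals0I)
    fix z assume "z \<in> polyline_image e12 \<inter> polyline_image e34"
    then have z12: "z \<in> polyline_image e12" and z34: "z \<in> polyline_image e34" by auto
    have "z \<notin> polyline_image (turn b (- 1) (4 * n + 2))"
      using opposite_spirals_disjoint[OF b(2)] z12 by (auto simp: e12_def)
    with z34 pow consider "z \<in> closed_segment (of_real R) (of_real (2 * R))" | "z \<in> polyline_image (loops n2 (2 * R))"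
      by (auto simp: e34_def polyline_image_append closed_segment_commute)
    \<comment> \<open>Edge 12 attains norm \<open>R\<close> only at its end \<open>- R\<close>,
      which the outer part of 34 misses.\<close>
    then have "R \<le> taxicab z \<and> z \<noteq> of_real (- R)"
    proof cases
      case 1
      then have "Im z = 0" "R \<le> Re z" using real_seg[OF 1] R by auto
      then show ?thesis using R by (auto simp: taxicab_def)
    next
      case 2
      then show ?thesis using taxicab_loops[OF 2] R by (auto simp: taxicab_def)
    qed
    moreover have "R = \<bar>1\<bar> * 2 ^ (4 * n + 2)" by (simp add: R_def power_add power_mult)
    ultimately show False
      using spiral_boundary[of z b 1 "4 * n + 2"] z12 b(2) pow by (auto simp: e12_def)
  qed
  have far: "R \<le> taxicab z"
    if "z \<in> closed_segment (of_real (- R)) (of_real (- 2 * R)) \<union> closed_segment (of_real (2 * R)) (of_real R)" for z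
  proof -
    from that consider "z \<in> closed_segment (of_real (- 2 * R)) (of_real (- R))"
      | "z \<in> closed_segment (of_real R) (of_real (2 * R))"
      by (auto simp: closed_segment_commute)
    then show ?thesis
    proof cases
      case 1
      from real_seg[OF 1] R show ?thesis by (auto simp: taxicab_def)
    next
      case 2
      from real_seg[OF 2] R show ?thesis by (auto simp: taxicab_def)
    qed
  qed
  \<comment> \<open>Edge 13 has norm at most 1, edge 24 at least \<open>R\<close>.\<close>
  have disj2: "polyline_image e13 \<inter> polyline_image e24 = {}"
  proof (rule equals0I)
    fix z assume "z \<in> polyline_image e13 \<inter> polyline_image e24"
    then have z13: "z \<in> closed_segment (of_real (- 1)) (of_real 1)" and z24: "z \<in> polyline_image e24"
      by (auto simp: e13_def closed_segment_commute)
    have "\<bar>Re z\<bar> \<le> 1" "Im z = 0" using real_seg[OF z13] by auto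
    then have "taxicab z \<le> 1" by (simp add: taxicab_def)
    moreover from z24 have "R \<le> taxicab z"
      using far[of z] R taxicab_loops[of z "n3 - p" "- 2 * R"] taxicab_unit_turn[of z "- 1" "- 2 * R" 2]
      by (auto simp: e24_def polyline_image_append taxicab_def)
    ultimately show False using R by simp
  qed
  \<comment> \<open>Edge 14 is on the positive axis with norm at most \<open>R\<close>; edge 23 is
    on the negative axis or at norm \<open>2 * R\<close>.\<close>
  have disj3: "polyline_image e14 \<inter> polyline_image e23 = {}"
  proof (rule equals0I)
    fix z assume "z \<in> polyline_image e14 \<inter> polyline_image e23"
    then have z14: "z \<in> closed_segment (of_real 1) (of_real R)" and z23: "z \<in> polyline_image e23"
      by (auto simp: e14_def)
    have z: "Im z = 0" "0 < Re z" "Re z \<le> R" using real_seg[OF z14] R by auto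
    from z23 consider "z \<in> closed_segment (of_real (- 2 * R)) (of_real (- R))"
      | "z \<in> polyline_image (loops n4 (- 2 * R))"
      | "z \<in> closed_segment (of_real (- 2 * R)) (of_real (- 1))"
      by (auto simp: e23_def polyline_image_append closed_segment_commute)
    then show False
    proof cases
      case 1
      from real_seg[OF 1] R z show False by auto
    next
      case 2
      from taxicab_loops[OF 2] R z show False by (auto simp: taxicab_def)
    next
      case 3
      from real_seg[OF 3] R z show False by auto
    qed
  qed

  \<comment> \<open>Winding numbers of the construction\<close>
  let ?f = "K4_from e12 e13 e14 e23 e24 e34"
  have len: "\<forall>e \<in> {e12, e13, e14, e23, e24, e34}. 2 \<le> length e"
    by (simp add: e12_def e13_def e14_def e23_def e24_def e34_def)
  note K4 = K4_from_almost_embedding[OF len ends disj1 disj2 disj3]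
  \<comment> \<open>All vertices are real and inside the loops; segments of the real axis count 0,
    so only the loops remain.\<close>
  have cross23: "crossings (of_real o') e23 = n4" if "\<bar>o'\<bar> < 2 * R" for o'
    using that crossings_loops[of o' "- 2 * R" n4] R
    by (simp add: e23_def crossings_Cons crossings_append) (simp add: crossing_def)
  have cross24: "crossings (of_real o') e24 = n3 - p" if "\<bar>o'\<bar> < 2 * R" for o'
  proof -
    have "crossings (of_real o') (turn (- 1) (- 2 * R) (2 * 1)) = 0"
      using that R by (subst crossings_turn) (auto simp: le_Suc_eq)
    then show ?thesis
      using that crossings_loops[of o' "- 2 * R" "n3 - p"] R
      by (simp add: e24_def crossings_Cons crossings_append) (simp add: crossing_def)
  qed
  have cross34: "crossings (of_real o') e34 = crossings (of_real o') (turn b (- 1) (4 * n + 2)) + n2"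
    if "\<bar>o'\<bar> < 2 * R" for o'
    using that crossings_loops[of o' "2 * R" n2] R pow
    by (simp add: e34_def crossings_append) (simp add: crossing_def)
  have cross13: "crossings (of_real o') e13 = 0" and cross14: "crossings (of_real o') e14 = 0" for o'
    by (simp_all add: e13_def e14_def crossing_def)
  have spiral12: "crossings (- 1) e12 = p" "crossings (of_real R) e12 = 0"
    using crossings_spiral[OF b(1), of n] by (auto simp: e12_def R_def b_def n_def)
  have spiral34: "crossings 1 e34 = p + 1 + n2" "crossings (of_real (- R)) e34 = n2"
  proof -
    have "crossings 1 (turn b (- 1) (4 * n + 2)) = p + 1"
      "crossings (of_real (- R)) (turn b (- 1) (4 * n + 2)) = 0"
      using crossings_spiral[OF b(1), of n] by (auto simp: R_def b_def n_def)
    then show "crossings 1 e34 = p + 1 + n2" "crossings (of_real (- R)) e34 = n2"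
      using cross34[of 1] cross34[of "- R"] R by simp_all
  qed
  \<comment> \<open>The count is \<open>n4 + (p + 1 + n2) - (n3 - p)\<close>, equal to
    \<open>n1\<close> by the choice of \<open>p\<close>.\<close>
  have "vertex_winding ?f 1 = n1"
    using K4(2) spiral34 cross23[of 1] cross24[of 1] R p by simp
  moreover have "vertex_winding ?f 2 = n2"
    using K4(3) spiral34 cross13[of "- R"] cross14[of "- R"] by simp
  moreover have "vertex_winding ?f 3 = n3"
    using K4(4) spiral12 cross24[of "- 1"] cross14[of "- 1"] R by simp
  moreover have "vertex_winding ?f 4 = n4"
    using K4(5) spiral12 cross23[of R] cross13[of R] R by simp
  ultimately show ?thesis using K4(1) by blast
qed

end
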